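(* Let $m$ be an odd positive integer and let $F:\mathbb{F}_{2^m}^3\to\mathbb{F}_{2^m}^3$ be defined by $F(x,y,z)=(f(x,y,z),f(y,z,x),f(z,x,y))$, where $f(x,y,z)=x^3+y^3+x^2z+xy^2+yz^2$. Then $F$ is a permutation of $\mathbb{F}_{2^m}^3$.
   Context: $\mathbb{F}_{2^m}$ denotes the finite field with $2^m$ elements and $\mathbb{F}_{2^m}^3$ the 3-dimensional vector space over it. A permutation of $\mathbb{F}_{2^m}^3$ is a bijection from $\mathbb{F}_{2^m}^3$ to itself. *)

theory Defs
  imports "HOL-Library.Cardinality"
begin

definition f_cubic :: "'a::field \<Rightarrow> 'a \<Rightarrow> 'a \<Rightarrow> 'a" where
  "f_cubic x y z = x ^ 3 + y ^ 3 + x\<^sup>2 * z + x * y\<^sup>2 + y * z\<^sup>2"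

definition F_cubic :: "'a::field \<times> 'a \<times> 'a \<Rightarrow> 'a \<times> 'a \<times> 'a" where
  "F_cubic = (\<lambda>(x, y, z). (f_cubic x y z, f_cubic y z x, f_cubic z x y))"

end

theory Submission
  imports Defs "HOL-Number_Theory.Residues"
begin

text \<open>
  Put \<open>S = x\<^sup>2z + y\<^sup>2x + z\<^sup>2y\<close>, \<open>T = x\<^sup>2y + y\<^sup>2z + z\<^sup>2x\<close> and \<open>p = x\<^sup>3 - y\<^sup>3\<close>, \<open>q = y\<^sup>3 - z\<^sup>3\<close>,
  \<open>r = z\<^sup>3 - x\<^sup>3\<close>. In characteristic 2 the three components of \<open>F\<close> are \<open>p + S\<close>, \<open>q + S\<close>, \<open>r + S\<close> and
  sum to \<open>S\<close>, so \<open>F\<close> determines \<open>p, q, r, S\<close>. The vector \<open>(x, y, z)\<close> is in the kernel of the matrix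
  with rows \<open>(T, r, -S)\<close>, \<open>(-S, T, p)\<close>, \<open>(q, -S, T)\<close>, whose determinant is
  \<open>T\<^sup>3 - S\<^sup>3 + pqr\<close>. Hence \<open>T\<^sup>3\<close> is determined too, and so is \<open>T\<close>, because cubing is injective for
  odd \<open>m\<close>. The matrix has rank 2 unless it vanishes, so it determines \<open>(x, y, z)\<close> up to a scalar
  \<open>\<lambda>\<close>, and homogeneity gives \<open>\<lambda>\<^sup>3 = 1\<close>, whence \<open>\<lambda> = 1\<close>.
\<close>

lemma finite_field_power_CARD:
  fixes x :: "'a :: {field, finite}"
  shows "x ^ CARD('a) = x"
proof (cases "x = 0")
  case False
  have "bij_betw ((*) x) (UNIV - {0}) (UNIV - {0})"
    by (rule bij_betw_byWitness[where f' = "\<lambda>y. y / x"]) (use False in auto)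
  then have "\<Prod>(UNIV - {0 :: 'a}) = (\<Prod>y\<in>UNIV - {0}. x * y)"
    by (rule prod.reindex_bij_betw[symmetric])
  also have "\<dots> = x ^ (CARD('a) - 1) * \<Prod>(UNIV - {0})"
    by (simp add: prod.distrib card_Diff_singleton)
  finally have "x ^ (CARD('a) - 1) = 1"
    by simp
  then show ?thesis
    by (metis finite_UNIV_card_ge_0 finite power_minus_mult mult_1)
qed simp

lemma two_eq_zero_if_CARD_power_2:
  assumes "CARD('a :: {field, finite}) = 2 ^ m"
  shows "(2 :: 'a) = 0"
proof -
  have "of_nat CARD('a) = (0 :: 'a)"
    using CHAR_dvd_CARD of_nat_eq_0_iff_char_dvd by blast
  then show ?thesis
    by (simp add: assms)
qed

lemma power2_inj_char_2:
  fixes a b :: "'a :: field"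
  assumes "(2 :: 'a) = 0" and "a\<^sup>2 = b\<^sup>2"
  shows "a = b"
proof -
  have "(a - b)\<^sup>2 = a\<^sup>2 - b\<^sup>2 - 2 * (b * (a - b))"
    by (simp add: power2_eq_square algebra_simps)
  then show ?thesis
    using assms by simp
qed

text \<open>For odd \<open>m\<close>, 3 divides \<open>2 ^ m + 1\<close>, so
  \<open>c\<^sup>2 = c ^ (2 ^ m + 1)\<close> is a power of \<open>c ^ 3\<close>. Hence cubes
  determine squares, and squaring is injective in characteristic 2.\<close>

lemma inj_cube_if_CARD_odd_power_2:
  assumes "odd m" and card: "CARD('a :: {field, finite}) = 2 ^ m"
  shows "inj (\<lambda>x :: 'a. x ^ 3)"
proof (rule injI)
  fix a b :: 'a
  assume eq: "a ^ 3 = b ^ 3"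
  obtain j where j: "m = 2 * j + 1"
    using \<open>odd m\<close> by (rule oddE)
  have "3 dvd (2 :: nat) ^ m + 1"
  proof -
    have "(4 :: nat) ^ j mod 3 = 1"
      by (induction j) (simp_all, presburger)
    then show ?thesis
      unfolding j power_add power_mult by simp presburger
  qed
  then obtain k where k: "CARD('a) + 1 = 3 * k"
    unfolding card by (rule dvdE)
  have "c\<^sup>2 = (c ^ 3) ^ k" for c :: 'a
    using finite_field_power_CARD[of c]
    by (simp add: power2_eq_square flip: power_mult k)
  then have "a\<^sup>2 = b\<^sup>2"
    using eq by simp
  then show "a = b"
    using two_eq_zero_if_CARD_power_2[OF card] power2_inj_char_2 by blast
qed

definition S_cubic :: "'a::comm_ring_1 \<Rightarrow> 'a \<Rightarrow> 'a \<Rightarrow> 'a" where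
  "S_cubic x y z = x\<^sup>2 * z + y\<^sup>2 * x + z\<^sup>2 * y"

definition T_cubic :: "'a::comm_ring_1 \<Rightarrow> 'a \<Rightarrow> 'a \<Rightarrow> 'a" where
  "T_cubic x y z = x\<^sup>2 * y + y\<^sup>2 * z + z\<^sup>2 * x"

lemma syzygies:
  "T_cubic x y z * x + (z ^ 3 - x ^ 3) * y - S_cubic x y z * z = 0"
  "- S_cubic x y z * x + T_cubic x y z * y + (x ^ 3 - y ^ 3) * z = 0"
  "(y ^ 3 - z ^ 3) * x - S_cubic x y z * y + T_cubic x y z * z = 0"
  unfolding S_cubic_def T_cubic_def power2_eq_square power3_eq_cube
  by (simp_all add: algebra_simps)

text \<open>This is the vanishing of the determinant of the matrix behind \<open>syzygies\<close>;
  its mixed term \<open>S * T * (p + q + r)\<close> drops out because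
  \<open>p + q + r = 0\<close>.\<close>

lemma T_cubic_power3:
  "T_cubic x y z ^ 3 =
    S_cubic x y z ^ 3 - (x ^ 3 - y ^ 3) * (y ^ 3 - z ^ 3) * (z ^ 3 - x ^ 3)"
  unfolding S_cubic_def T_cubic_def power2_eq_square power3_eq_cube
  by (simp add: algebra_simps)

text \<open>The degenerate case: equal cubes force \<open>x = y = z\<close>, and then the form S
  becomes \<open>3 * x ^ 3\<close>.\<close>

lemma cube_differences_S_cubic_eq_0:
  fixes x y z :: "'a :: field"
  assumes "inj (\<lambda>x :: 'a. x ^ 3)" and "(3 :: 'a) \<noteq> 0"
    and "x ^ 3 - y ^ 3 = 0" and "y ^ 3 - z ^ 3 = 0" and "S_cubic x y z = 0"
  shows "x = 0 \<and> y = 0 \<and> z = 0"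
proof -
  have "x = y" "y = z"
    using assms(3,4) by (auto intro: injD[OF assms(1)])
  moreover have "S_cubic x x x = 3 * x ^ 3"
    by (simp add: S_cubic_def power2_eq_square power3_eq_cube)
  ultimately show ?thesis
    using assms(2,5) by simp
qed

text \<open>A vector orthogonal to two others is parallel to their cross product; vanishing minors
  express this without division.\<close>

lemma orthogonal_to_two_vectors:
  fixes a b c :: "'a :: comm_ring_1"
  assumes "a * x + b * y + c * z = 0" and "a * x' + b * y' + c * z' = 0"
  shows "a * (z * x' - x * z') = b * (y * z' - z * y')"
    and "b * (x * y' - y * x') = c * (z * x' - x * z')"
    and "c * (y * z' - z * y') = a * (x * y' - y * x')"
proof -
  let ?u = "a * x + b * y + c * z" and ?v = "a * x' + b * y' + c * z'"
  have "a * (z * x' - x * z') - b * (y * z' - z * y') = z * ?v - z' * ?u"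
    "b * (x * y' - y * x') - c * (z * x' - x * z') = x * ?v - x' * ?u"
    "c * (y * z' - z * y') - a * (x * y' - y * x') = y * ?v - y' * ?u"
    by (simp_all add: algebra_simps)
  then show "a * (z * x' - x * z') = b * (y * z' - z * y')"
    "b * (x * y' - y * x') = c * (z * x' - x * z')"
    "c * (y * z' - z * y') = a * (x * y' - y * x')"
    unfolding assms by simp_all
qed

text \<open>Parallelism is transitive through the nonzero vector \<open>(k, l, n)\<close>.\<close>

lemma proportional_to_common_vector:
  fixes a b c a' b' c' k l n :: "'a :: field"
  assumes "a * l = b * k" "b * n = c * l" "c * k = a * n"
    and "a' * l = b' * k" "b' * n = c' * l" "c' * k = a' * n"
    and "k \<noteq> 0 \<or> l \<noteq> 0 \<or> n \<noteq> 0"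
  shows "a * b' = b * a'" and "b * c' = c * b'" and "c * a' = a * c'"
proof -
  \<comment> \<open>Each of \<open>k\<close>, \<open>l\<close>, \<open>n\<close> annihilates
    \<open>a * b' - b * a'\<close>, and one of them is nonzero. The variables are generalised so
    that cyclic rotation yields the other two minors.\<close>
  have minor: "a * b' = b * a'"
    if "a * l = b * k" "a' * l = b' * k" "b' * n = c' * l" "c' * k = a' * n"
      "k \<noteq> 0 \<or> l \<noteq> 0 \<or> n \<noteq> 0" for a b a' b' c' k l n :: 'a
  proof -
    have "k * (a * b') = k * (b * a')"
    proof -
      have "k * (a * b') = a * (b' * k)" by (simp add: mult_ac)
      also have "\<dots> = (a * l) * a'" by (simp add: mult_ac flip: that(2))
      also have "\<dots> = k * (b * a')" by (simp add: that(1) mult_ac)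
      finally show ?thesis .
    qed
    moreover have "l * (a * b') = l * (b * a')"
    proof -
      have "l * (a * b') = (a * l) * b'" by (simp add: mult_ac)
      also have "\<dots> = b * (b' * k)" by (simp add: that(1) mult_ac)
      also have "\<dots> = l * (b * a')" by (simp add: mult_ac flip: that(2))
      finally show ?thesis .
    qed
    moreover have "n * (a * b') = n * (b * a')"
    proof -
      have "n * (a * b') = a * (b' * n)" by (simp add: mult_ac)
      also have "\<dots> = (a * l) * c'" by (simp add: that(3) mult_ac)
      also have "\<dots> = b * (c' * k)" by (simp add: that(1) mult_ac)
      also have "\<dots> = n * (b * a')" by (simp add: that(4) mult_ac)
      finally show ?thesis .
    qed
    ultimately show ?thesis
      using that(5) by auto
  qed
  show "a * b' = b * a'"
    by (rule minor[OF assms(1,4,5,6,7)])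
  show "b * c' = c * b'"
    by (rule minor[OF assms(2,5,6,4)]) (use assms(7) in auto)
  show "c * a' = a * c'"
    by (rule minor[OF assms(3,6,4,5)]) (use assms(7) in auto)
qed

text \<open>Were two kernel vectors not parallel, every row would be parallel to their nonzero cross
  product, so all 2x2 minors of the matrix would vanish, forcing
  \<open>p = q = S = 0\<close>.\<close>

lemma syzygy_matrix_kernel_dim_1:
  fixes p q r S T :: "'a :: field"
  assumes "(3 :: 'a) \<noteq> 0" and sum: "p + q + r = 0"
    and X: "T * x + r * y - S * z = 0" "- S * x + T * y + p * z = 0" "q * x - S * y + T * z = 0"
    and X': "T * x' + r * y' - S * z' = 0" "- S * x' + T * y' + p * z' = 0"
      "q * x' - S * y' + T * z' = 0"
    and nz: "p \<noteq> 0 \<or> q \<noteq> 0 \<or> S \<noteq> 0"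
  shows "y * z' = z * y' \<and> z * x' = x * z' \<and> x * y' = y * x'"
proof (rule ccontr)
  assume "\<not> ?thesis"
  then have n: "y * z' - z * y' \<noteq> 0 \<or> z * x' - x * z' \<noteq> 0 \<or> x * y' - y * x' \<noteq> 0"
    by simp
  have row1: "T * x + r * y + (- S) * z = 0" "T * x' + r * y' + (- S) * z' = 0"
    and row3: "q * x + (- S) * y + T * z = 0" "q * x' + (- S) * y' + T * z' = 0"
    using X X' by simp_all
  note R1 = orthogonal_to_two_vectors[OF row1]
    and R2 = orthogonal_to_two_vectors[OF X(2) X'(2)]
    and R3 = orthogonal_to_two_vectors[OF row3]
  note minors = proportional_to_common_vector[OF R1 R2 n] proportional_to_common_vector[OF R1 R3 n]
    proportional_to_common_vector[OF R2 R3 n]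
  \<comment> \<open>Three of the minors equate \<open>T\<^sup>2\<close> with \<open>- S * r\<close>,
    \<open>- S * q\<close> and \<open>- S * p\<close>.\<close>
  have "3 * T\<^sup>2 = - S * (p + q + r)"
    using minors(1,6,8) by (auto simp: power2_eq_square algebra_simps)
  then have T: "T = 0"
    using assms(1) sum by simp
  then have S: "S = 0"
    using minors by auto
  have "p * q = 0" "p * r = 0" "q * r = 0"
    using minors T S by auto
  then have "p = 0" "q = 0"
    using sum by auto
  with S nz show False
    by simp
qed

theorem cube_differences_S_cubic_inj:
  fixes x y z x' y' z' :: "'a :: field"
  assumes inj: "inj (\<lambda>x :: 'a. x ^ 3)" and three: "(3 :: 'a) \<noteq> 0"
    and p: "x ^ 3 - y ^ 3 = x' ^ 3 - y' ^ 3"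
    and q: "y ^ 3 - z ^ 3 = y' ^ 3 - z' ^ 3"
    and S: "S_cubic x y z = S_cubic x' y' z'"
  shows "x = x' \<and> y = y' \<and> z = z'"
proof (cases "x ^ 3 - y ^ 3 = 0 \<and> y ^ 3 - z ^ 3 = 0 \<and> S_cubic x y z = 0")
  case True
  then show ?thesis
    using cube_differences_S_cubic_eq_0[OF inj three, of x y z]
      cube_differences_S_cubic_eq_0[OF inj three, of x' y' z'] p q S by simp
next
  case False
  have r: "z ^ 3 - x ^ 3 = z' ^ 3 - x' ^ 3"
  proof -
    have "c - a = - (a - b) - (b - c)" for a b c :: 'a
      by simp
    then show ?thesis
      using p q by metis
  qed
  have "T_cubic x y z ^ 3 = T_cubic x' y' z' ^ 3"
    unfolding T_cubic_power3 p q r S ..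
  then have T: "T_cubic x y z = T_cubic x' y' z'"
    by (rule injD[OF inj])
  \<comment> \<open>Folding turns the primed matrix into the unprimed one, so both vectors lie in
    the same kernel.\<close>
  have par: "y * z' = z * y' \<and> z * x' = x * z' \<and> x * y' = y * x'"
    by (rule syzygy_matrix_kernel_dim_1[OF three _ syzygies
          syzygies[where x = x' and y = y' and z = z', folded p q r S T]])
      (use False in auto)
  have "x \<noteq> 0 \<or> y \<noteq> 0 \<or> z \<noteq> 0"
    using False by (auto simp: S_cubic_def)
  then obtain k where k: "x' = k * x" "y' = k * y" "z' = k * z"
  proof (elim disjE)
    assume "x \<noteq> 0"
    then show thesis
      using par by (intro that[of "x' / x"]) (auto simp: field_simps)
  next
    assume "y \<noteq> 0"
    then show thesis
      using par by (intro that[of "y' / y"]) (auto simp: field_simps)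
  next
    assume "z \<noteq> 0"
    then show thesis
      using par by (intro that[of "z' / z"]) (auto simp: field_simps)
  qed
  have "S_cubic (k * x) (k * y) (k * z) = k ^ 3 * S_cubic x y z"
    by (simp add: S_cubic_def power2_eq_square power3_eq_cube algebra_simps)
  then have "(k ^ 3 - 1) * S_cubic x y z = 0"
    using S unfolding k by (simp add: algebra_simps)
  moreover have "(k ^ 3 - 1) * (x ^ 3 - y ^ 3) = 0" "(k ^ 3 - 1) * (y ^ 3 - z ^ 3) = 0"
    using p q unfolding k by (simp_all add: power_mult_distrib algebra_simps)
  ultimately have "k ^ 3 = 1 ^ 3"
    using False by auto
  then have "k = 1"
    by (rule injD[OF inj])
  then show ?thesis
    using k by simp
qed

theorem theorem1:
  fixes m :: nat
  assumes "m > 0" and "odd m"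
    and "CARD('a::{field,finite}) = 2 ^ m"
  shows "bij (F_cubic :: 'a \<times> 'a \<times> 'a \<Rightarrow> 'a \<times> 'a \<times> 'a)"
proof -
  have two: "(2 :: 'a) = 0"
    using assms(3) by (rule two_eq_zero_if_CARD_power_2)
  have "(3 :: 'a) = 2 + 1"
    by simp
  then have three: "(3 :: 'a) \<noteq> 0"
    using two by simp
  have f: "f_cubic x y z = x ^ 3 - y ^ 3 + S_cubic x y z" for x y z :: 'a
  proof -
    have "f_cubic x y z = x ^ 3 - y ^ 3 + S_cubic x y z + 2 * y ^ 3"
      by (simp add: f_cubic_def S_cubic_def algebra_simps)
    then show ?thesis
      using two by simp
  qed
  have S: "S_cubic x y z = f_cubic x y z + f_cubic y z x + f_cubic z x y" for x y z :: 'a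
  proof -
    \<comment> \<open>The cube differences cancel cyclically, leaving three copies of S.\<close>
    have "f_cubic x y z + f_cubic y z x + f_cubic z x y = S_cubic x y z + 2 * S_cubic x y z"
      unfolding f by (simp add: S_cubic_def algebra_simps)
    then show ?thesis
      using two by simp
  qed
  have "x = x' \<and> y = y' \<and> z = z'" if "F_cubic (x, y, z) = F_cubic (x', y', z')"
    for x y z x' y' z' :: 'a
  proof -
    from that have F: "f_cubic x y z = f_cubic x' y' z'" "f_cubic y z x = f_cubic y' z' x'"
      "f_cubic z x y = f_cubic z' x' y'"
      by (simp_all add: F_cubic_def)
    then have S_eq: "S_cubic x y z = S_cubic x' y' z'"
      unfolding S by simp
    have "S_cubic y z x = S_cubic x y z" for x y z :: 'a
      by (simp add: S_cubic_def)
    then have "x ^ 3 - y ^ 3 = x' ^ 3 - y' ^ 3" "y ^ 3 - z ^ 3 = y' ^ 3 - z' ^ 3"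
      using F(1,2) S_eq unfolding f by simp_all
    then show ?thesis
      using cube_differences_S_cubic_inj[OF inj_cube_if_CARD_odd_power_2[OF assms(2,3)] three]
        S_eq by blast
  qed
  then have "inj (F_cubic :: 'a \<times> 'a \<times> 'a \<Rightarrow> 'a \<times> 'a \<times> 'a)"
    by (auto simp: inj_def)
  then show ?thesis
    by (simp add: bij_def finite_UNIV_inj_surj)
qed

end
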